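(* For every fixed integer $n\ge2$, $\mu_{\mathrm c}(n,s)=O\big(s^{(n+1)/(n-1)}\big)$, and therefore $s_{n,k}=\Omega\big(k^{(n-1)/(n+1)}\big)$. That is, for every $n\ge2$ there are constants $C,C'>0$ depending only on $n$ such that $\mu_{\mathrm c}(n,s)\le C\,s^{(n+1)/(n-1)}$ for all integers $s\ge1$ and $s_{n,k}\ge C'\,k^{(n-1)/(n+1)}$ for all integers $k\ge1$.
   Context: A set of points is in convex position if none of its points is a convex combination of the others. For $V\subseteq\mathbb{R}^n$, $M(V)=\{\tfrac12(x_1+x_2): x_1,x_2\in V\}\setminus V$. $\mu_{\mathrm c}(n,s)$ is the minimum of $|M(V)|$ over all sets $V\subseteq\mathbb{R}^n$ in convex position with $|V|=s$. For $k\ge0$, $s_{n,k}=\min\{s : \mu_{\mathrm c}(n,s)\ge k\}$, the minimum being over positive integers $s$. *)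

theory Defs
  imports "HOL-Analysis.Analysis"
begin

definition convex_position :: "'a::real_vector set \<Rightarrow> bool" where
  "convex_position V \<longleftrightarrow> (\<forall>x\<in>V. x \<notin> convex hull (V - {x}))"

definition midpoint_set :: "'a::real_vector set \<Rightarrow> 'a set" where
  "midpoint_set V = {midpoint x1 x2 | x1 x2. x1 \<in> V \<and> x2 \<in> V} - V"

text \<open>The dimension \<open>n\<close> is \<open>CARD('n)\<close>. The \<open>LEAST\<close> below is a genuine minimum whenever
  \<open>n \<ge> 2\<close>: any \<open>s\<close> points of a sphere are in convex position. The finiteness condition only
  matters for \<open>s = 0\<close>, since \<open>card\<close> of an infinite set is \<open>0\<close>.\<close>

definition mu_c :: "'n::finite itself \<Rightarrow> nat \<Rightarrow> nat" where
  "mu_c _ s = (LEAST m. \<exists>V :: (real ^ 'n) set.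
     finite V \<and> card V = s \<and> convex_position V \<and> m = card (midpoint_set V))"

text \<open>The \<open>LEAST\<close> is again a minimum over a nonempty set for \<open>n \<ge> 2\<close>: the midpoints of a fixed
  point of \<open>V\<close> with the other points are distinct and outside \<open>V\<close>, so \<open>\<mu>\<^sub>c(n,s) \<ge> s - 1\<close>.\<close>

definition s_min :: "'n::finite itself \<Rightarrow> nat \<Rightarrow> nat" where
  "s_min n k = (LEAST s. 0 < s \<and> k \<le> mu_c n s)"

end

theory Submission
  imports Defs
begin

text \<open>
  Lift the grid \<open>{0,\<dots>,r-1}\<^sup>n\<^sup>-\<^sup>1\<close> to the paraboloid \<open>z = |x|\<^sup>2\<close> in \<open>\<real>\<^sup>n\<close>. The paraboloid is
  strictly convex, so all \<open>r\<^sup>n\<^sup>-\<^sup>1\<close> lifted points are in convex position. Their heights are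
  integers of size \<open>O(r\<^sup>2)\<close>, hence every midpoint lies in the lattice \<open>(1/2)\<int>\<^sup>n\<close> inside a box
  with sides \<open>O(r)\<close> in \<open>n - 1\<close> directions and \<open>O(r\<^sup>2)\<close> in the last one: there are only
  \<open>O(r\<^sup>n\<^sup>+\<^sup>1)\<close> midpoints, although there are about \<open>r\<^sup>2\<^sup>n\<^sup>-\<^sup>2\<close> pairs
  (\<open>card_midpoint_set_lifted_grid_le\<close>). Choosing \<open>s\<close> of the lifted points for \<open>r\<close> about
  \<open>s\<^bsup>1/(n-1)\<^esup>\<close> yields the upper bound on \<open>\<mu>\<^sub>c\<close>.

  The bound on \<open>s\<^sub>n\<^sub>,\<^sub>k\<close> follows by inverting the first bound at \<open>s = s\<^sub>n\<^sub>,\<^sub>k\<close>, once it is known that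
  \<open>\<mu>\<^sub>c(n,s)\<close> is unbounded in \<open>s\<close>, so that the minimum defining \<open>s\<^sub>n\<^sub>,\<^sub>k\<close> is attained. This is
  \<open>mu_c_ge\<close>: in convex position no midpoint of two distinct points is again one of the points,
  and the midpoints with one fixed endpoint are distinct.
\<close>

section \<open>Points in convex position\<close>

lemma convex_position_subset:
  assumes "convex_position V" "W \<subseteq> V"
  shows "convex_position W"
  using assms hull_mono[of "W - {x}" "V - {x}" convex for x]
  unfolding convex_position_def by blast

lemma midpoint_notin_convex_position:
  assumes "convex_position V" "x \<in> V" "y \<in> V" "x \<noteq> y"
  shows "midpoint x y \<notin> V"
proof
  assume m: "midpoint x y \<in> V"
  have "midpoint x y \<in> convex hull {x, y}"
    by (metis midpoint_in_closed_segment segment_convex_hull)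
  moreover have "{x, y} \<subseteq> V - {midpoint x y}"
    using assms midpoint_eq_endpoint[of x y]
    by (metis Diff_iff empty_subsetI insert_subset singletonD)
  ultimately have "midpoint x y \<in> convex hull (V - {midpoint x y})"
    using hull_mono by blast
  then show False
    using assms(1) m unfolding convex_position_def by blast
qed

lemma finite_midpoint_set:
  assumes "finite V"
  shows "finite (midpoint_set V)"
proof -
  have "midpoint_set V \<subseteq> (\<lambda>(x, y). midpoint x y) ` (V \<times> V)"
    unfolding midpoint_set_def by auto
  then show ?thesis
    using assms finite_subset by blast
qed

text \<open>It suffices to count the midpoints that have one fixed point of \<open>V\<close> as an endpoint.\<close>

lemma card_le_Suc_card_midpoint_set:
  assumes "finite V" "convex_position V"
  shows "card V \<le> Suc (card (midpoint_set V))"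
proof (cases "V = {}")
  case False
  then obtain x where x: "x \<in> V" by blast
  have sub: "midpoint x ` (V - {x}) \<subseteq> midpoint_set V"
    using midpoint_notin_convex_position[OF assms(2) x] x
    unfolding midpoint_set_def by auto
  have "inj_on (midpoint x) (V - {x})"
    by (auto simp: inj_on_def midpoint_def)
  then have "card (V - {x}) \<le> card (midpoint_set V)"
    by (metis card_image card_mono finite_midpoint_set[OF assms(1)] sub)
  then show ?thesis
    using x assms(1) by simp
qed simp

section \<open>Lattice points on a paraboloid\<close>

definition paraboloid :: "'n::finite \<Rightarrow> (real ^ 'n) set" where
  "paraboloid i0 = {v. v $ i0 = (\<Sum>i\<in>-{i0}. (v $ i)\<^sup>2)}"

definition lift :: "'n::finite \<Rightarrow> ('n \<Rightarrow> nat) \<Rightarrow> real ^ 'n" where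
  "lift i0 f = (\<chi> i. if i = i0 then real (\<Sum>j\<in>-{i0}. (f j)\<^sup>2) else real (f i))"

definition lifted_grid :: "'n::finite \<Rightarrow> nat \<Rightarrow> (real ^ 'n) set" where
  "lifted_grid i0 r = lift i0 ` (-{i0} \<rightarrow>\<^sub>E {..<r})"

text \<open>The tangent hyperplane at a point \<open>x\<close> of the paraboloid separates \<open>x\<close> strictly from the
  rest: for \<open>y\<close> on the paraboloid, the height of \<open>y\<close> above that hyperplane is the squared
  distance between the projections of \<open>x\<close> and \<open>y\<close>.\<close>

lemma convex_position_paraboloid: "convex_position (paraboloid i0)"
  unfolding convex_position_def
proof
  fix x :: "real ^ 'a"
  assume x: "x \<in> paraboloid i0"
  \<comment> \<open>normal vector of the tangent hyperplane at \<open>x\<close>\<close>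
  define a :: "real ^ 'a" where "a = (\<chi> i. if i = i0 then 1 else - 2 * x $ i)"
  have inner_a: "a \<bullet> y = y $ i0 - (\<Sum>i\<in>-{i0}. 2 * x $ i * y $ i)" for y
  proof -
    have "a \<bullet> y = a $ i0 * y $ i0 + (\<Sum>i\<in>-{i0}. a $ i * y $ i)"
      by (simp add: inner_vec_def sum.remove[of UNIV i0] Compl_eq_Diff_UNIV)
    also have "(\<Sum>i\<in>-{i0}. a $ i * y $ i) = (\<Sum>i\<in>-{i0}. - (2 * x $ i * y $ i))"
      by (rule sum.cong) (auto simp: a_def)
    finally show ?thesis
      by (simp add: a_def sum_negf)
  qed
  have "paraboloid i0 - {x} \<subseteq> {y. a \<bullet> y > a \<bullet> x}"
  proof
    fix y assume y: "y \<in> paraboloid i0 - {x}"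
    have "a \<bullet> y - a \<bullet> x =
        (\<Sum>i\<in>-{i0}. ((y $ i)\<^sup>2 - 2 * x $ i * y $ i) - ((x $ i)\<^sup>2 - 2 * x $ i * x $ i))"
      using x y by (simp add: inner_a paraboloid_def sum_subtractf)
    also have "\<dots> = (\<Sum>i\<in>-{i0}. (y $ i - x $ i)\<^sup>2)"
      by (rule sum.cong[OF refl]) (simp add: power2_eq_square algebra_simps)
    finally have "a \<bullet> y - a \<bullet> x = (\<Sum>i\<in>-{i0}. (y $ i - x $ i)\<^sup>2)" .
    moreover have "\<exists>i\<in>-{i0}. y $ i \<noteq> x $ i"
    proof (rule ccontr)
      assume "\<not> ?thesis"
      then have eq: "y $ i = x $ i" if "i \<noteq> i0" for i
        using that by auto
      then have "y $ i0 = x $ i0"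
        using x y by (simp add: paraboloid_def)
      then show False
        using eq y by (metis DiffD2 insertI1 vec_eq_iff)
    qed
    then have "(\<Sum>i\<in>-{i0}. (y $ i - x $ i)\<^sup>2) > 0"
      by (auto intro: sum_pos2)
    ultimately show "y \<in> {y. a \<bullet> y > a \<bullet> x}"
      by simp
  qed
  then have "convex hull (paraboloid i0 - {x}) \<subseteq> {y. a \<bullet> y > a \<bullet> x}"
    by (rule hull_minimal) (rule convex_halfspace_gt)
  then show "x \<notin> convex hull (paraboloid i0 - {x})"
    by blast
qed

lemma lifted_grid_subset_paraboloid: "lifted_grid i0 r \<subseteq> paraboloid i0"
proof -
  have "lift i0 f \<in> paraboloid i0" for f
  proof -
    have "(\<Sum>i\<in>-{i0}. (lift i0 f $ i)\<^sup>2) = (\<Sum>i\<in>-{i0}. (real (f i))\<^sup>2)"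
      by (rule sum.cong) (auto simp: lift_def)
    then show ?thesis
      by (simp add: paraboloid_def lift_def)
  qed
  then show ?thesis
    unfolding lifted_grid_def by blast
qed

lemma finite_lifted_grid: "finite (lifted_grid i0 r)"
  unfolding lifted_grid_def by (intro finite_imageI finite_PiE) auto

lemma card_lifted_grid:
  "card (lifted_grid (i0::'n::finite) r) = r ^ (CARD('n) - 1)"
proof -
  have "inj_on (lift i0) (-{i0} \<rightarrow>\<^sub>E {..<r})"
  proof (rule inj_onI)
    fix f g
    assume fg: "f \<in> -{i0} \<rightarrow>\<^sub>E {..<r}" "g \<in> -{i0} \<rightarrow>\<^sub>E {..<r}" "lift i0 f = lift i0 g"
    show "f = g"
    proof (rule PiE_ext[OF fg(1,2)])
      fix i assume "i \<in> -{i0}"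
      then show "f i = g i"
        using arg_cong[OF fg(3), of "\<lambda>v. v $ i"] by (simp add: lift_def)
    qed
  qed
  then show ?thesis
    by (simp add: lifted_grid_def card_image card_PiE Compl_eq_Diff_UNIV)
qed

text \<open>Twice a midpoint is an integer vector, so the midpoints are counted by the integer points of
  a box with side \<open>2 r\<close> in the grid directions and \<open>2 n r\<^sup>2\<close> in the direction of the axis.\<close>

lemma card_midpoint_set_lifted_grid_le:
  assumes "W \<subseteq> lifted_grid (i0::'n::finite) r"
  shows "card (midpoint_set W) \<le> (2 * CARD('n) * r\<^sup>2 + 1) * (2 * r) ^ (CARD('n) - 1)"
proof -
  define B :: "'n \<Rightarrow> nat set"
    where "B i = (if i = i0 then {..2 * CARD('n) * r\<^sup>2} else {..<2 * r})" for i
  define half :: "('n \<Rightarrow> nat) \<Rightarrow> real ^ 'n" where "half h = (\<chi> i. real (h i) / 2)" for h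
  have finB: "finite (PiE UNIV B)"
    by (intro finite_PiE) (auto simp: B_def)
  have sub: "midpoint_set W \<subseteq> half ` PiE UNIV B"
  proof
    fix m assume "m \<in> midpoint_set W"
    then obtain f g where fg: "f \<in> -{i0} \<rightarrow>\<^sub>E {..<r}" "g \<in> -{i0} \<rightarrow>\<^sub>E {..<r}"
      and m: "m = midpoint (lift i0 f) (lift i0 g)"
      using assms unfolding midpoint_set_def lifted_grid_def by blast
    define q where "q f = (\<Sum>j\<in>-{i0}. (f j)\<^sup>2)" for f :: "'n \<Rightarrow> nat"
    have q: "q h \<le> CARD('n) * r\<^sup>2" if "h \<in> -{i0} \<rightarrow>\<^sub>E {..<r}" for h
    proof -
      have "h j \<le> r" if "j \<in> -{i0}" for j
        using PiE_mem[OF \<open>h \<in> _\<close> that] by simp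
      then have "q h \<le> (\<Sum>j\<in>-{i0}. r\<^sup>2)"
        unfolding q_def by (intro sum_mono power_mono) auto
      also have "\<dots> \<le> (\<Sum>j\<in>(UNIV::'n set). r\<^sup>2)"
        by (rule sum_mono2) auto
      finally show ?thesis by simp
    qed
    define h where "h i = (if i = i0 then q f + q g else f i + g i)" for i
    have "h i \<in> B i" for i
    proof (cases "i = i0")
      case True
      then show ?thesis
        using q[OF fg(1)] q[OF fg(2)] by (simp add: B_def h_def)
    next
      case False
      then have "f i < r" "g i < r"
        using PiE_mem[OF fg(1), of i] PiE_mem[OF fg(2), of i] by auto
      then show ?thesis
        using False by (simp add: B_def h_def)
    qed
    then have "h \<in> PiE UNIV B"
      by (simp add: PiE_UNIV_domain)
    moreover have "m = half h"
      unfolding m half_def midpoint_def h_def lift_def q_def by (simp add: vec_eq_iff)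
    ultimately show "m \<in> half ` PiE UNIV B" by blast
  qed
  have "card (midpoint_set W) \<le> card (PiE UNIV B)"
    using card_mono[OF finite_imageI[OF finB] sub] card_image_le[OF finB] by (rule order_trans)
  also have "\<dots> = card (B i0) * (\<Prod>i\<in>-{i0}. card (B i))"
    by (simp add: card_PiE prod.remove[of UNIV i0] Compl_eq_Diff_UNIV)
  also have "(\<Prod>i\<in>-{i0}. card (B i)) = (\<Prod>i\<in>-{i0}. 2 * r)"
    by (rule prod.cong) (auto simp: B_def)
  finally show ?thesis
    by (simp add: B_def Compl_eq_Diff_UNIV)
qed

text \<open>Rounding \<open>s\<^bsup>1/(n-1)\<^esup> \<ge> 1\<close> up to an integer \<open>r\<close> at most doubles it, and \<open>s\<close> points can then be
  picked from the \<open>r\<^sup>n\<^sup>-\<^sup>1\<close> lifted ones. The factors \<open>2\<^sup>n\<^sup>-\<^sup>1\<close> from halving the coordinates and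
  \<open>2\<^sup>n\<^sup>+\<^sup>1\<close> from rounding make up the \<open>4\<^sup>n\<close>.\<close>

lemma ex_convex_position_few_midpoints:
  assumes n: "CARD('n::finite) \<ge> 2" and s: "s \<ge> 1"
  shows "\<exists>W :: (real ^ 'n) set. finite W \<and> card W = s \<and> convex_position W \<and>
    real (card (midpoint_set W))
      \<le> 3 * real CARD('n) * 4 ^ CARD('n) *
          real s powr ((real CARD('n) + 1) / (real CARD('n) - 1))"
proof -
  define n where "n = CARD('n)"
  obtain d where d: "n = Suc d" "d \<ge> 1"
    using assms(1) that[of "n - 1"] unfolding n_def by linarith
  define t where "t = real s powr (1 / d)"
  define r where "r = nat \<lceil>t\<rceil>"
  have t1: "t \<ge> 1"
    using s unfolding t_def by (simp add: ge_one_powr_ge_zero)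
  have r: "t \<le> real r" "real r \<le> 2 * t"
    using t1 unfolding r_def by linarith+
  have td: "t ^ d = real s"
    using s d t1 by (simp add: t_def powr_powr flip: powr_realpow)
  have tn: "t ^ (n + 1) = real s powr ((real n + 1) / (real n - 1))"
  proof -
    have "t ^ (n + 1) = t powr (real n + 1)"
      using t1 powr_realpow[of t "n + 1"] by (simp add: add.commute)
    also have "\<dots> = real s powr (1 / real d * (real n + 1))"
      unfolding t_def by (rule powr_powr)
    finally show ?thesis
      by (simp add: d)
  qed
  have "real s \<le> real r ^ d"
    unfolding td[symmetric] using r(1) t1 by (intro power_mono) auto
  then have "s \<le> r ^ d"
    by (metis of_nat_le_iff of_nat_power)
  \<comment> \<open>any coordinate can serve as the axis of the paraboloid\<close>
  define i0 :: 'n where "i0 = undefined"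
  have "s \<le> card (lifted_grid i0 r)"
    using \<open>s \<le> r ^ d\<close> d by (simp add: card_lifted_grid n_def)
  then obtain W where W: "W \<subseteq> lifted_grid i0 r" "card W = s"
    by (meson obtain_subset_with_card_n)
  have r1: "real r \<ge> 1"
    using r(1) t1 by linarith
  have "real (card (midpoint_set W)) \<le> real ((2 * n * r\<^sup>2 + 1) * (2 * r) ^ d)"
    using card_midpoint_set_lifted_grid_le[OF W(1)] d unfolding n_def
    by (simp only: of_nat_le_iff) simp
  also have "\<dots> = (2 * real n * (real r)\<^sup>2 + 1) * (2 * real r) ^ d"
    by (simp add: algebra_simps)
  also have "\<dots> \<le> (3 * real n * (real r)\<^sup>2) * (2 * real r) ^ d"
  proof (rule mult_right_mono)
    have "1 \<le> real n * (real r)\<^sup>2"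
      using d r1 mult_mono[of 1 "real n" 1 "(real r)\<^sup>2"] by simp
    then show "2 * real n * (real r)\<^sup>2 + 1 \<le> 3 * real n * (real r)\<^sup>2"
      by simp
  qed simp
  also have "\<dots> = 3 * real n * 2 ^ d * real r ^ (n + 1)"
    by (simp add: d power_mult_distrib power2_eq_square)
  also have "\<dots> \<le> 3 * real n * 2 ^ d * (2 * t) ^ (n + 1)"
    using r by (intro mult_left_mono power_mono) auto
  also have "\<dots> = 3 * real n * 4 ^ n * t ^ (n + 1)"
  proof -
    have "(4::real) ^ n = 2 ^ d * 2 ^ (n + 1)"
      using power_mult_distrib[of "2::real" 2 d] by (simp add: d)
    then show ?thesis
      by (simp only: power_mult_distrib mult.assoc)
  qed
  finally have "real (card (midpoint_set W)) \<le> 3 * real n * 4 ^ n * t ^ (n + 1)" .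
  moreover have "convex_position W"
    using convex_position_paraboloid W(1) lifted_grid_subset_paraboloid
    by (blast intro: convex_position_subset)
  moreover have "finite W"
    using W(1) finite_lifted_grid finite_subset by blast
  ultimately show ?thesis
    using W(2) tn unfolding n_def by auto
qed

section \<open>Bounds on the extremal functions\<close>

lemma mu_c_le:
  assumes "CARD('n::finite) \<ge> 2" "s \<ge> 1"
  shows "real (mu_c TYPE('n) s)
    \<le> 3 * real CARD('n) * 4 ^ CARD('n) *
        real s powr ((real CARD('n) + 1) / (real CARD('n) - 1))"
proof -
  obtain W :: "(real ^ 'n) set" where W: "finite W" "card W = s" "convex_position W"
    and le: "real (card (midpoint_set W))
      \<le> 3 * real CARD('n) * 4 ^ CARD('n) *
          real s powr ((real CARD('n) + 1) / (real CARD('n) - 1))"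
    using ex_convex_position_few_midpoints[OF assms] by blast
  have "mu_c TYPE('n) s \<le> card (midpoint_set W)"
    unfolding mu_c_def using W by (intro Least_le) blast
  then show ?thesis
    using le by linarith
qed

lemma mu_c_ge:
  assumes "CARD('n::finite) \<ge> 2" "s \<ge> 1"
  shows "s \<le> Suc (mu_c TYPE('n) s)"
proof -
  have "\<exists>m. \<exists>V :: (real ^ 'n) set.
      finite V \<and> card V = s \<and> convex_position V \<and> m = card (midpoint_set V)"
    using ex_convex_position_few_midpoints[OF assms] by blast
  from LeastI_ex[OF this] obtain V :: "(real ^ 'n) set"
    where "finite V" "card V = s" "convex_position V" "mu_c TYPE('n) s = card (midpoint_set V)"
    unfolding mu_c_def by blast
  then show ?thesis
    using card_le_Suc_card_midpoint_set[of V] by simp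
qed

theorem proposition4p9:
  assumes "CARD('n::finite) \<ge> 2"
  shows "\<exists>C C' :: real. C > 0 \<and> C' > 0 \<and>
    (\<forall>s::nat. s \<ge> 1 \<longrightarrow>
       real (mu_c TYPE('n) s)
         \<le> C * real s powr ((real CARD('n) + 1) / (real CARD('n) - 1))) \<and>
    (\<forall>k::nat. k \<ge> 1 \<longrightarrow>
       real (s_min TYPE('n) k)
         \<ge> C' * real k powr ((real CARD('n) - 1) / (real CARD('n) + 1)))"
proof -
  define n where "n = real CARD('n)"
  define C where "C = 3 * n * 4 ^ CARD('n)"
  define p where "p = (n + 1) / (n - 1)"
  define q where "q = (n - 1) / (n + 1)"
  have n: "n \<ge> 2"
    using assms unfolding n_def by simp
  have C: "C > 0"
    using n unfolding C_def by simp
  have q: "q > 0"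
    using n unfolding q_def by simp
  have pq: "p * q = 1"
    using n unfolding p_def q_def by simp
  have upper: "real (mu_c TYPE('n) s) \<le> C * real s powr p" if "s \<ge> 1" for s
    using mu_c_le[OF assms that] unfolding C_def p_def n_def .
  have lower: "real (s_min TYPE('n) k) \<ge> (1 / C) powr q * real k powr q" if "k \<ge> 1" for k
  proof -
    define s where "s = s_min TYPE('n) k"
    have "0 < k + 1 \<and> k \<le> mu_c TYPE('n) (k + 1)"
      using mu_c_ge[OF assms, of "k + 1"] by simp
    then have "0 < s \<and> k \<le> mu_c TYPE('n) s"
      unfolding s_def s_min_def by (rule LeastI)
    then have s: "s \<ge> 1" "real k \<le> real (mu_c TYPE('n) s)"
      by auto
    then have "real k \<le> C * real s powr p"
      using upper[of s] by linarith
    then have "1 / C * real k \<le> real s powr p"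
      using C by (simp add: field_simps)
    then have "(1 / C * real k) powr q \<le> (real s powr p) powr q"
      using C q by (intro powr_mono2) auto
    also have "\<dots> = real s"
      using s(1) by (simp add: powr_powr pq)
    finally show ?thesis
      using C by (simp only: s_def powr_mult)
  qed
  have "(1 / C) powr q > 0"
    using C by simp
  then show ?thesis
    using C upper lower unfolding p_def q_def n_def by blast
qed

end
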